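(* Let $\mathcal{X}\subseteq\mathbb{R}^n$ and $\mathcal{U}\subseteq\mathbb{R}^m$ be boxes and let $f=f_0+f_{\mathrm{NN}}$ be the neural network control system dynamics described in the context. For any $\varepsilon>0$ and any integer $N_u\ge1$, the subpaving $\mathbb{C}$ returned by Algorithm 1 (described in the context) with inputs $\mathcal{X},\mathcal{U},\varepsilon,N_u$ is a controlled invariant set for the system $x_{k+1}=f(x_k,u_k)$, $x_k\in\mathcal{X}$, $u_k\in\mathcal{U}$.
   Context: A box is a Cartesian product of closed intervals $[\underline{x},\overline{x}]$ with $\underline{x}\le\overline{x}$. Its width is $w([\bm x])=\|\overline{\bm x}-\underline{\bm x}\|_\infty$. A subpaving of a box is a finite set of boxes contained in it with pairwise disjoint interiors; it is also identified with the union of its boxes. Containments and equalities involving subpavings below are between these unions. System: $f=f_0+f_{\mathrm{NN}}:\mathbb{R}^n\times\mathbb{R}^m\to\mathbb{R}^n$. Here $f_0$ is twice continuously differentiable on an open set containing $\mathcal{X}\times\mathcal{U}$ with bounded second-order partial derivatives, and $f_{\mathrm{NN}}$ is a feed-forward neural network: $z^{(0)}=(x,u)$, $z^{(i)}=\sigma(W^{(i)}z^{(i-1)}+b^{(i)})$ for $i=1,\dots,\ell-1$, $f_{\mathrm{NN}}(x,u)=W^{(\ell)}z^{(\ell-1)}+b^{(\ell)}$, with $\sigma$ an activation function (such as ReLU or $\tanh$) applied elementwise. A set $\mathcal{S}\subseteq\mathcal{X}$ is a controlled invariant set (CIS) if for every $x\in\mathcal{S}$ there exists $u\in\mathcal{U}$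 with $f(x,u)\in\mathcal{S}$. In particular, $\emptyset$ is a CIS. Control-affine enclosure of $f$ over a state box $[\bm b]\subseteq\mathcal{X}$ and a control box $[\bm u_s]\subseteq\mathcal{U}$: a map $[f]_{[\bm b]}(u)=\prod_{j=1}^n[\underline{a}_j^\top u+\underline{c}_j,\ \overline{a}_j^\top u+\overline{c}_j]$, with coefficients $\underline{a}_j,\overline{a}_j\in\mathbb{R}^m$ and $\underline{c}_j,\overline{c}_j\in\mathbb{R}$, such that $f(x,u)\in[f]_{[\bm b]}(u)$ for all $x\in[\bm b]$, $u\in[\bm u_s]$. The algorithms use one such enclosure for each pair of a state box and a control slice. Algorithm 1 (inputs $\mathcal{X},\mathcal{U},\varepsilon,N_u$): set $\mathbb{C}_0=\{\mathcal{X}\}$. For $k=0,1,2,\dots$ compute $\mathbb{C}_{k+1}=\mathrm{InPre}(\mathbb{C}_k,\varepsilon,\mathcal{U},N_u)$ by Algorithm 2. If $\mathbb{C}_{k+1}=\emptyset$, return $\emptyset$. If $\mathbb{C}_{k+1}=\mathbb{C}_k$, stop and return $\mathbb{C}_{k+1}$. Algorithm 2 (InPre, inputs $\mathbb{C}_k,\varepsilon,\mathcal{U},N_u$): initialize a queue $\mathcal{Q}$ with the boxes of $\mathbb{C}_k$ and $\mathbb{C}_{k+1}=\emptyset$. Partition $\mathcal{U}=\bigcup_{i=1}^{N_u}[\bm u_s^{(i)}]$ into $N_u$ boxes (control slices). While $\mathcal{Q}\ne\emptyset$, pop a box $[\bm b]$. For each slice $i=1,\dots,N_u$, take a control-affine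 enclosure $[f]_{[\bm b]}$ over $[\bm b]$ and $[\bm u_s^{(i)}]$, and form the hyperplane arrangement $\mathcal{A}([\bm b])$ in $\mathbb{R}^m$ given by the equations $\underline{a}_j^\top u+\underline{c}_j=g_j^{(q)}$ and $\overline{a}_j^\top u+\overline{c}_j=g_j^{(q)}$ ($1\le j\le n$, $1\le q\le N_j$), where $g_j^{(1)}<\dots<g_j^{(N_j)}$ are all the $j$-th coordinates of vertices of boxes in $\mathbb{C}_k$, together with the $2m$ boundary hyperplanes of the slice $[\bm u_s^{(i)}]$. For each region $R$ of $\mathcal{A}([\bm b])$ contained in $[\bm u_s^{(i)}]$, where a region is a full-dimensional maximal connected set of points with the same signs with respect to all these equations, choose one $u^*\in R$ and test whether $[f]_{[\bm b]}(u^* )\subseteq\mathbb{C}_k$. Declare $[\bm b]$ feasible if the test succeeds for at least one region of at least one slice. If $[\bm b]$ is feasible, add it to $\mathbb{C}_{k+1}$. Otherwise, if $w([\bm b])>\varepsilon$, bisect $[\bm b]$ into two boxes with disjoint interiors whose union is $[\bm b]$ and put both in $\mathcal{Q}$. Otherwise discard $[\bm b]$. When $\mathcal{Q}=\emptyset$, return $\mathbb{C}_{k+1}$. *)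

theory Defs
  imports "HOL-Analysis.Analysis"
begin

section \<open>Boxes and subpavings\<close>

definition is_box :: "(real ^ 'n) set \<Rightarrow> bool" where
  "is_box B \<longleftrightarrow> (\<exists>lo hi. (\<forall>j. lo $ j \<le> hi $ j) \<and> B = cbox lo hi)"

text \<open>On nonempty boxes the library functions \<^const>\<open>interval_lowerbound\<close> and
  \<^const>\<open>interval_upperbound\<close> return the two defining corners.\<close>

definition box_width :: "(real ^ 'n) set \<Rightarrow> real" where
  "box_width B = infnorm (interval_upperbound B - interval_lowerbound B)"

definition box_vertices :: "(real ^ 'n) set \<Rightarrow> (real ^ 'n) set" where
  "box_vertices B =
     {v. \<forall>j. v $ j = interval_lowerbound B $ j \<or> v $ j = interval_upperbound B $ j}"

definition disjoint_interiors :: "'a::topological_space set \<Rightarrow> 'a set \<Rightarrow> bool" where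
  "disjoint_interiors A B \<longleftrightarrow> interior A \<inter> interior B = {}"

definition subpaving :: "(real ^ 'n) set \<Rightarrow> (real ^ 'n) set set \<Rightarrow> bool" where
  "subpaving X \<C> \<longleftrightarrow>
     finite \<C> \<and> (\<forall>B\<in>\<C>. is_box B \<and> B \<subseteq> X) \<and> pairwise disjoint_interiors \<C>"


section \<open>The system\<close>

definition C1_on :: "'a::euclidean_space set \<Rightarrow> ('a \<Rightarrow> 'b::real_normed_vector) \<Rightarrow> bool" where
  "C1_on S g \<longleftrightarrow> (\<forall>p\<in>S. g differentiable (at p)) \<and>
     (\<forall>i\<in>Basis. continuous_on S (\<lambda>p. frechet_derivative g (at p) i))"

definition C2_on :: "'a::euclidean_space set \<Rightarrow> ('a \<Rightarrow> 'b::real_normed_vector) \<Rightarrow> bool" where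
  "C2_on S g \<longleftrightarrow> C1_on S g \<and>
     (\<forall>i\<in>Basis. C1_on S (\<lambda>p. frechet_derivative g (at p) i))"

definition bounded_second_partials_on ::
    "'a::euclidean_space set \<Rightarrow> ('a \<Rightarrow> 'b::real_normed_vector) \<Rightarrow> bool" where
  "bounded_second_partials_on S g \<longleftrightarrow>
     (\<forall>i\<in>Basis. \<forall>j\<in>Basis.
        bounded ((\<lambda>p. frechet_derivative (\<lambda>q. frechet_derivative g (at q) i) (at p) j) ` S))"

text \<open>Layer widths of a network vary, so layer vectors are functions \<^typ>\<open>nat \<Rightarrow> real\<close>, of
  which only the entries below the layer width are used. The coordinates of \<^typ>\<open>real ^ 'n\<close> are
  numbered \<open>0, \<dots>, CARD('n) - 1\<close> by the bijections \<^const>\<open>to_nat_on\<close> and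
  \<^const>\<open>from_nat_into\<close>.\<close>

definition nn_input :: "(real ^ 'n) \<times> (real ^ 'm) \<Rightarrow> nat \<Rightarrow> real" where
  "nn_input p k =
     (if k < CARD('n) then fst p $ from_nat_into UNIV k
      else snd p $ from_nat_into UNIV (k - CARD('n)))"

primrec nn_layer :: "(real \<Rightarrow> real) \<Rightarrow> (nat \<Rightarrow> nat) \<Rightarrow> (nat \<Rightarrow> nat \<Rightarrow> nat \<Rightarrow> real) \<Rightarrow>
    (nat \<Rightarrow> nat \<Rightarrow> real) \<Rightarrow> (nat \<Rightarrow> real) \<Rightarrow> nat \<Rightarrow> nat \<Rightarrow> real" where
  "nn_layer \<sigma> d W b z 0 = z"
| "nn_layer \<sigma> d W b z (Suc i) =
     (\<lambda>r. \<sigma> ((\<Sum>c<d i. W (Suc i) r c * nn_layer \<sigma> d W b z i c) + b (Suc i) r))"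

text \<open>\<open>d i\<close> is the width of layer \<open>i\<close>, and \<open>W i\<close> and \<open>b i\<close> are the weight matrix (of size
  \<open>d i \<times> d (i - 1)\<close>) and the bias vector of layer \<open>i\<close>. The last layer has no activation.\<close>

definition feedforward_nn ::
    "(real \<Rightarrow> real) \<Rightarrow> ((real ^ 'n) \<times> (real ^ 'm) \<Rightarrow> real ^ 'n) \<Rightarrow> bool" where
  "feedforward_nn \<sigma> g \<longleftrightarrow>
     (\<exists>(l::nat) d W b. 1 \<le> l \<and> d 0 = CARD('n) + CARD('m) \<and> d l = CARD('n) \<and>
        (\<forall>p. g p = (\<chi> j. let r = to_nat_on (UNIV :: 'n set) j in
           (\<Sum>c<d (l - 1). W l r c * nn_layer \<sigma> d W b (nn_input p) (l - 1) c) + b l r)))"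

definition controlled_invariant ::
    "((real ^ 'n) \<times> (real ^ 'm) \<Rightarrow> real ^ 'n) \<Rightarrow> (real ^ 'n) set \<Rightarrow> (real ^ 'm) set \<Rightarrow>
     (real ^ 'n) set \<Rightarrow> bool" where
  "controlled_invariant f X U S \<longleftrightarrow> S \<subseteq> X \<and> (\<forall>x\<in>S. \<exists>u\<in>U. f (x, u) \<in> S)"


section \<open>Control-affine enclosures\<close>

text \<open>The rows of \<open>A_lo\<close>, \<open>A_hi\<close> are the coefficient vectors of the lower and upper bounds.\<close>

record ('n, 'm) ca_map =
  A_lo :: "real ^ 'm ^ 'n"
  c_lo :: "real ^ 'n"
  A_hi :: "real ^ 'm ^ 'n"
  c_hi :: "real ^ 'n"

definition ca_eval :: "('n::finite, 'm::finite) ca_map \<Rightarrow> real ^ 'm \<Rightarrow> (real ^ 'n) set" where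
  "ca_eval E u = cbox (A_lo E *v u + c_lo E) (A_hi E *v u + c_hi E)"

definition is_enclosure ::
    "((real ^ 'n) \<times> (real ^ 'm) \<Rightarrow> real ^ 'n) \<Rightarrow> (real ^ 'n) set \<Rightarrow> (real ^ 'm) set \<Rightarrow>
     ('n::finite, 'm::finite) ca_map \<Rightarrow> bool" where
  "is_enclosure f B s E \<longleftrightarrow> (\<forall>x\<in>B. \<forall>u\<in>s. f (x, u) \<in> ca_eval E u)"


section \<open>Hyperplane arrangements and their regions\<close>

definition grid_coords :: "(real ^ 'n) set set \<Rightarrow> 'n \<Rightarrow> real set" where
  "grid_coords \<C> j = (\<lambda>v. v $ j) ` (\<Union>B\<in>\<C>. box_vertices B)"

text \<open>An equation is given by the affine function whose zero set it describes.\<close>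

definition arrangement ::
    "(real ^ 'n) set set \<Rightarrow> ('n::finite, 'm::finite) ca_map \<Rightarrow> (real ^ 'm) set \<Rightarrow>
     (real ^ 'm \<Rightarrow> real) set" where
  "arrangement \<C> E s =
     {\<lambda>u. A_lo E $ j \<bullet> u + c_lo E $ j - g | j g. g \<in> grid_coords \<C> j} \<union>
     {\<lambda>u. A_hi E $ j \<bullet> u + c_hi E $ j - g | j g. g \<in> grid_coords \<C> j} \<union>
     {\<lambda>u. u $ i - interval_lowerbound s $ i | i. True} \<union>
     {\<lambda>u. u $ i - interval_upperbound s $ i | i. True}"

definition same_signs :: "('a \<Rightarrow> real) set \<Rightarrow> 'a set \<Rightarrow> bool" where
  "same_signs H R \<longleftrightarrow> (\<forall>h\<in>H. \<forall>u\<in>R. \<forall>v\<in>R. sgn (h u) = sgn (h v))"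

definition is_region :: "('a::euclidean_space \<Rightarrow> real) set \<Rightarrow> 'a set \<Rightarrow> bool" where
  "is_region H R \<longleftrightarrow>
     aff_dim R = int DIM('a) \<and> connected R \<and> same_signs H R \<and>
     (\<forall>R'. R \<subseteq> R' \<and> connected R' \<and> same_signs H R' \<longrightarrow> R' = R)"

definition regions_in ::
    "(real ^ 'n) set set \<Rightarrow> ('n::finite, 'm::finite) ca_map \<Rightarrow> (real ^ 'm) set \<Rightarrow>
     (real ^ 'm) set set" where
  "regions_in \<C> E s = {R. is_region (arrangement \<C> E s) R \<and> R \<subseteq> s}"


section \<open>The algorithms\<close>

text \<open>The algorithms leave several choices open (order of the initial queue, partition of the
  control box, sample points, place of bisection). They are therefore modelled as relations that
  hold for every outcome that some sequence of admissible choices produces. The enclosures are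
  supplied by \<open>enc\<close>, for each pair of a state box and a control slice.\<close>

definition control_slices ::
    "(real ^ 'm) set \<Rightarrow> nat \<Rightarrow> (nat \<Rightarrow> (real ^ 'm) set) \<Rightarrow> bool" where
  "control_slices U Nu s \<longleftrightarrow>
     (\<forall>i\<in>{1..Nu}. is_box (s i)) \<and> (\<Union>i\<in>{1..Nu}. s i) = U \<and>
     pairwise (\<lambda>i j. disjoint_interiors (s i) (s j)) {1..Nu}"

text \<open>\<open>feasibility_test enc Nu s \<C> B r\<close>: for some choice of one sample point in each region, the
  feasibility test of the box \<open>B\<close> has outcome \<open>r\<close>.\<close>

definition feasibility_test ::
    "((real ^ 'n) set \<Rightarrow> (real ^ 'm) set \<Rightarrow> ('n::finite, 'm::finite) ca_map) \<Rightarrow> nat \<Rightarrow>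
     (nat \<Rightarrow> (real ^ 'm) set) \<Rightarrow> (real ^ 'n) set set \<Rightarrow> (real ^ 'n) set \<Rightarrow> bool \<Rightarrow> bool" where
  "feasibility_test enc Nu s \<C> B r \<longleftrightarrow>
     (\<exists>pick :: nat \<Rightarrow> (real ^ 'm) set \<Rightarrow> real ^ 'm.
        (\<forall>i\<in>{1..Nu}. \<forall>R\<in>regions_in \<C> (enc B (s i)) (s i). pick i R \<in> R) \<and>
        (r \<longleftrightarrow> (\<exists>i\<in>{1..Nu}. \<exists>R\<in>regions_in \<C> (enc B (s i)) (s i).
                  ca_eval (enc B (s i)) (pick i R) \<subseteq> \<Union>\<C>)))"

definition bisects :: "(real ^ 'n) set \<Rightarrow> (real ^ 'n) set \<Rightarrow> (real ^ 'n) set \<Rightarrow> bool" where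
  "bisects B B1 B2 \<longleftrightarrow>
     is_box B1 \<and> is_box B2 \<and> disjoint_interiors B1 B2 \<and> B1 \<union> B2 = B"

text \<open>One iteration of the while loop; the state is the queue together with the boxes
  accumulated so far.\<close>

inductive inpre_step ::
    "((real ^ 'n) set \<Rightarrow> (real ^ 'm) set \<Rightarrow> ('n::finite, 'm::finite) ca_map) \<Rightarrow> real \<Rightarrow> nat \<Rightarrow>
     (nat \<Rightarrow> (real ^ 'm) set) \<Rightarrow> (real ^ 'n) set set \<Rightarrow>
     (real ^ 'n) set list \<times> (real ^ 'n) set set \<Rightarrow>
     (real ^ 'n) set list \<times> (real ^ 'n) set set \<Rightarrow> bool"
  for enc \<epsilon> Nu s \<C>
where
  feasible: "feasibility_test enc Nu s \<C> B True \<Longrightarrow>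
    inpre_step enc \<epsilon> Nu s \<C> (B # Q, D) (Q, insert B D)"
| bisect: "feasibility_test enc Nu s \<C> B False \<Longrightarrow> box_width B > \<epsilon> \<Longrightarrow> bisects B B1 B2 \<Longrightarrow>
    inpre_step enc \<epsilon> Nu s \<C> (B # Q, D) (Q @ [B1, B2], D)"
| discard: "feasibility_test enc Nu s \<C> B False \<Longrightarrow> \<not> box_width B > \<epsilon> \<Longrightarrow>
    inpre_step enc \<epsilon> Nu s \<C> (B # Q, D) (Q, D)"

definition inpre ::
    "((real ^ 'n) set \<Rightarrow> (real ^ 'm) set \<Rightarrow> ('n::finite, 'm::finite) ca_map) \<Rightarrow>
     (real ^ 'n) set set \<Rightarrow> real \<Rightarrow> (real ^ 'm) set \<Rightarrow> nat \<Rightarrow> (real ^ 'n) set set \<Rightarrow> bool" where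
  "inpre enc \<C> \<epsilon> U Nu \<C>' \<longleftrightarrow>
     (\<exists>s Q. control_slices U Nu s \<and> set Q = \<C> \<and> distinct Q \<and>
        (inpre_step enc \<epsilon> Nu s \<C>)\<^sup>*\<^sup>* (Q, {}) ([], \<C>'))"

text \<open>\<open>iterates enc X U \<epsilon> Nu \<C>\<close>: a run reaches the iterate \<open>\<C>\<close> and has not stopped before it.
  Iterates are compared as sets of points, that is, through their unions.\<close>

inductive iterates ::
    "((real ^ 'n) set \<Rightarrow> (real ^ 'm) set \<Rightarrow> ('n::finite, 'm::finite) ca_map) \<Rightarrow>
     (real ^ 'n) set \<Rightarrow> (real ^ 'm) set \<Rightarrow> real \<Rightarrow> nat \<Rightarrow> (real ^ 'n) set set \<Rightarrow> bool"
  for enc X U \<epsilon> Nu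
where
  init: "iterates enc X U \<epsilon> Nu {X}"
| step: "iterates enc X U \<epsilon> Nu \<C> \<Longrightarrow> inpre enc \<C> \<epsilon> U Nu \<C>' \<Longrightarrow> \<C>' \<noteq> {} \<Longrightarrow> \<Union>\<C>' \<noteq> \<Union>\<C> \<Longrightarrow>
    iterates enc X U \<epsilon> Nu \<C>'"

inductive algorithm_returns ::
    "((real ^ 'n) set \<Rightarrow> (real ^ 'm) set \<Rightarrow> ('n::finite, 'm::finite) ca_map) \<Rightarrow>
     (real ^ 'n) set \<Rightarrow> (real ^ 'm) set \<Rightarrow> real \<Rightarrow> nat \<Rightarrow> (real ^ 'n) set set \<Rightarrow> bool"
  for enc X U \<epsilon> Nu
where
  empty: "iterates enc X U \<epsilon> Nu \<C> \<Longrightarrow> inpre enc \<C> \<epsilon> U Nu {} \<Longrightarrow>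
    algorithm_returns enc X U \<epsilon> Nu {}"
| fixpoint: "iterates enc X U \<epsilon> Nu \<C> \<Longrightarrow> inpre enc \<C> \<epsilon> U Nu \<C>' \<Longrightarrow> \<C>' \<noteq> {} \<Longrightarrow> \<Union>\<C>' = \<Union>\<C> \<Longrightarrow>
    algorithm_returns enc X U \<epsilon> Nu \<C>'"


section \<open>Every returned set of boxes is a subpaving\<close>

lemma disjoint_interiors_sym: "disjoint_interiors A B \<Longrightarrow> disjoint_interiors B A"
  by (auto simp: disjoint_interiors_def)

lemma disjoint_interiors_subset:
  "disjoint_interiors A B \<Longrightarrow> A' \<subseteq> A \<Longrightarrow> disjoint_interiors A' B"
  unfolding disjoint_interiors_def using interior_mono[of A' A] by blast

lemma sorted_wrt_disjoint_interiors:
  "pairwise disjoint_interiors (set Q) \<Longrightarrow> distinct Q \<Longrightarrow> sorted_wrt disjoint_interiors Q"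
  by (induction Q) (auto simp: pairwise_insert)

definition inpre_inv ::
    "(real ^ 'n) set \<Rightarrow> (real ^ 'n) set list \<times> (real ^ 'n) set set \<Rightarrow> bool" where
  "inpre_inv X st \<longleftrightarrow> (case st of (Q, D) \<Rightarrow>
     subpaving X D \<and> (\<forall>B\<in>set Q. is_box B \<and> B \<subseteq> X) \<and>
     sorted_wrt disjoint_interiors Q \<and> (\<forall>B\<in>set Q. \<forall>B'\<in>D. disjoint_interiors B B'))"

lemma inpre_step_inv:
  assumes "inpre_step enc \<epsilon> Nu s \<C> st st'" "inpre_inv X st"
  shows "inpre_inv X st'"
  using assms
proof (cases rule: inpre_step.cases)
  case (feasible B Q D)
  then show ?thesis using assms(2)
    by (auto simp: inpre_inv_def subpaving_def pairwise_insert intro: disjoint_interiors_sym)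
next
  case (bisect B B1 B2 Q D)
  have sub: "B1 \<subseteq> B" "B2 \<subseteq> B" and d: "disjoint_interiors B1 B2" and "is_box B1" "is_box B2"
    using bisect(5) by (auto simp: bisects_def)
  moreover have "disjoint_interiors C B1" "disjoint_interiors C B2"
    if "disjoint_interiors B C" for C
    using that sub by (blast intro: disjoint_interiors_subset disjoint_interiors_sym)+
  ultimately show ?thesis using assms(2) bisect(1,2)
    by (auto simp: inpre_inv_def sorted_wrt_append intro: disjoint_interiors_sym)
next
  case (discard B Q D)
  then show ?thesis using assms(2) by (auto simp: inpre_inv_def)
qed

lemma inpre_subpaving:
  assumes "subpaving X \<C>" "inpre enc \<C> \<epsilon> U Nu \<C>'"
  shows "subpaving X \<C>'"
proof -
  obtain s Q where Q: "set Q = \<C>" "distinct Q"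
      "(inpre_step enc \<epsilon> Nu s \<C>)\<^sup>*\<^sup>* (Q, {}) ([], \<C>')"
    using assms(2) by (auto simp: inpre_def)
  have "inpre_inv X (Q, {})"
    using assms(1) Q(1,2) sorted_wrt_disjoint_interiors[of Q]
    by (auto simp: inpre_inv_def subpaving_def)
  with Q(3) have "inpre_inv X ([], \<C>')"
    by (induction rule: rtranclp_induct) (auto intro: inpre_step_inv)
  then show ?thesis by (simp add: inpre_inv_def)
qed

lemma iterates_subpaving:
  assumes "iterates enc X U \<epsilon> Nu \<C>" "is_box X"
  shows "subpaving X \<C>"
  using assms by induction (auto simp: subpaving_def[of X "{X}"] intro: inpre_subpaving)

lemma algorithm_returns_subpaving:
  assumes "algorithm_returns enc X U \<epsilon> Nu \<C>" "is_box X"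
  shows "subpaving X \<C>"
  using assms by cases (auto intro: inpre_subpaving iterates_subpaving)

end

theory Submission
  imports Defs
begin

text \<open>A box enters the output of \<^const>\<open>inpre\<close> only after a successful test: some sample control
  \<open>u\<close> of a slice has an enclosure value inside the previous iterate. The enclosure is valid on the
  whole box, so this one \<open>u\<close> steers every state of the box into the previous iterate
  (\<open>inpre_steers_into_previous\<close>). The algorithm returns a nonempty result only when the last two
  iterates cover the same set of points, so the steering ends in the result itself, which is controlled
  invariance; the empty result is trivially invariant.\<close>

text \<open>The first rule of \<^const>\<open>inpre_step\<close> is the only one that extends the accumulated set, so
  having passed the test is an invariant of that set.\<close>

lemma inpre_output_feasible:
  assumes "(inpre_step enc \<epsilon> Nu s \<C>)\<^sup>*\<^sup>* (Q, {}) ([], \<C>')" and "B \<in> \<C>'"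
  shows "feasibility_test enc Nu s \<C> B True"
proof -
  have "\<forall>B\<in>snd st. feasibility_test enc Nu s \<C> B True"
    if "(inpre_step enc \<epsilon> Nu s \<C>)\<^sup>*\<^sup>* (Q, {}) st" for st
    using that by induction (auto elim!: inpre_step.cases)
  from this[OF assms(1)] assms(2) show ?thesis by simp
qed

text \<open>Each sample point lies in a region, each region in its slice and each slice in \<open>U\<close>; hence
  the control found by the test is admissible.\<close>

lemma inpre_steers_into_previous:
  assumes inpre: "inpre enc \<C> \<epsilon> U Nu \<C>'"
    and enc: "\<And>B s. is_box B \<Longrightarrow> B \<subseteq> X \<Longrightarrow> is_box s \<Longrightarrow> s \<subseteq> U \<Longrightarrow> is_enclosure f B s (enc B s)"
    and x: "x \<in> \<Union>\<C>'"
    and boxes: "\<And>B. B \<in> \<C>' \<Longrightarrow> is_box B" "\<And>B. B \<in> \<C>' \<Longrightarrow> B \<subseteq> X"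
  shows "\<exists>u\<in>U. f (x, u) \<in> \<Union>\<C>"
proof -
  obtain s Q where slices: "control_slices U Nu s"
    and run: "(inpre_step enc \<epsilon> Nu s \<C>)\<^sup>*\<^sup>* (Q, {}) ([], \<C>')"
    using inpre by (auto simp: inpre_def)
  obtain B where B: "B \<in> \<C>'" "x \<in> B"
    using x by blast
  obtain i R u where i: "i \<in> {1..Nu}" and R: "R \<in> regions_in \<C> (enc B (s i)) (s i)" "u \<in> R"
    and sub: "ca_eval (enc B (s i)) u \<subseteq> \<Union>\<C>"
    using inpre_output_feasible[OF run B(1)] unfolding feasibility_test_def by blast
  have u: "u \<in> s i"
    using R by (auto simp: regions_in_def)
  have slice: "is_box (s i)" "s i \<subseteq> U"
    using slices i by (auto simp: control_slices_def)
  have "is_enclosure f B (s i) (enc B (s i))"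
    using enc boxes[OF B(1)] slice by blast
  then have "f (x, u) \<in> ca_eval (enc B (s i)) u"
    using B(2) u by (simp add: is_enclosure_def)
  with sub u slice(2) show ?thesis by blast
qed

theorem theorem1:
  fixes X :: "(real ^ 'n) set" and U :: "(real ^ 'm) set"
    and f f0 fNN :: "(real ^ 'n) \<times> (real ^ 'm) \<Rightarrow> real ^ 'n"
    and \<sigma> :: "real \<Rightarrow> real" and \<epsilon> :: real and Nu :: nat
    and enc :: "(real ^ 'n) set \<Rightarrow> (real ^ 'm) set \<Rightarrow> ('n, 'm) ca_map"
    and \<C> :: "(real ^ 'n) set set"
  assumes "is_box X" and "is_box U"
    and "f = (\<lambda>p. f0 p + fNN p)"
    and "\<exists>S. open S \<and> X \<times> U \<subseteq> S \<and> C2_on S f0 \<and> bounded_second_partials_on S f0"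
    and "feedforward_nn \<sigma> fNN"
    and "\<epsilon> > 0" and "Nu \<ge> 1"
    and "\<And>B s. is_box B \<Longrightarrow> B \<subseteq> X \<Longrightarrow> is_box s \<Longrightarrow> s \<subseteq> U \<Longrightarrow> is_enclosure f B s (enc B s)"
    and "algorithm_returns enc X U \<epsilon> Nu \<C>"
  shows "controlled_invariant f X U (\<Union>\<C>)"
  using assms(9)
proof cases
  case empty
  then show ?thesis by (simp add: controlled_invariant_def)
next
  case (fixpoint \<C>\<^sub>k)
  have "subpaving X \<C>"
    using assms(9,1) by (rule algorithm_returns_subpaving)
  then have boxes: "is_box B" "B \<subseteq> X" if "B \<in> \<C>" for B
    using that by (auto simp: subpaving_def)
  have "\<exists>u\<in>U. f (x, u) \<in> \<Union>\<C>" if "x \<in> \<Union>\<C>" for x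
    using inpre_steers_into_previous[OF fixpoint(2) assms(8) that] boxes fixpoint(4) by simp
  then show ?thesis
    using boxes(2) by (auto simp: controlled_invariant_def)
qed

end
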